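(* Let $n \in \mathbb{N} = \{1,2,\dots\}$, let $\mathcal{SNM} := \{k \in \mathbb{N} : S_2(k) = \mathrm{nM}(k)\}$ and $\mathcal{SNM}_1 := \{k \in \mathbb{N} : S_2(k) = \mathrm{nM}_1(k)\}$. 1. $S_2(2^n - n) = 2^n$, and for all integers $k \ge 0$: $S_2(k) = 2^n$ if and only if $2^n - n \le k \le 2^n - 1$. 2. $2^n - n \in \mathcal{SNM}$, while $2^n - n + 1, \dots, 2^n - 1 \notin \mathcal{SNM}$. 3. If $n \ge 2$, then $2^n - n - 1 \in \mathcal{SNM}$ with $S_2(2^n - n - 1) = 2^n - 2$. 4. If $n \ge 3$, then $2^n - n + 1 \in \mathcal{SNM}_1$.
   Context: For an integer $k \ge 0$, $S_2(k)$ denotes the smallest integer $m \ge 0$ such that $2^k$ divides $m!$, with the convention $S_2(0) = 0$. $\mathrm{nM} : \mathbb{N} \to \mathbb{N}$ is the strictly increasing enumeration of the natural numbers $\ge 1$ that are not of the form $2^m - 1$, $m \in \mathbb{N}$ (initial values $2,4,5,6,8,9,10,11,12,13,14,16,17$). $\mathrm{nM}_1 : \mathbb{N} \to \mathbb{N}$ is defined by $\mathrm{nM}_1(2^m - m + 1) := \mathrm{nM}(2^m - m + 1) - 1 = 2^m$ for $m \ge 3$, and $\mathrm{nM}_1(k) := \mathrm{nM}(k)$ for all $k \in \mathbb{N}$ not of the form $2^m - m + 1$ with $m \ge 3$. *)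

theory Defs
  imports Main "HOL-Library.Infinite_Set"
begin

(* For k = 0 the least m is 0, which is the usual convention. *)
definition S2 :: "nat \<Rightarrow> nat" where
  "S2 k = (LEAST m. 2 ^ k dvd (fact m :: nat))"

definition non_Mersenne :: "nat set" where
  "non_Mersenne = {j. j \<ge> 1 \<and> \<not> (\<exists>m\<ge>1. j = 2 ^ m - 1)}"

(* The enumeration is indexed from 1 (nM 1 = 2, nM 2 = 4, nM 3 = 5, ...), whereas enumerate
   counts from 0.  The value at 0 lies outside the intended domain and is irrelevant. *)
definition nM :: "nat \<Rightarrow> nat" where
  "nM k = enumerate non_Mersenne (k - 1)"

(* No subtraction truncates: m < 2 ^ m, and every element of non_Mersenne is positive. *)
definition nM1 :: "nat \<Rightarrow> nat" where
  "nM1 k = (if \<exists>m\<ge>3. k = 2 ^ m - m + 1 then nM k - 1 else nM k)"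

definition SNM :: "nat set" where
  "SNM = {k. k \<ge> 1 \<and> S2 k = nM k}"

definition SNM1 :: "nat set" where
  "SNM1 = {k. k \<ge> 1 \<and> S2 k = nM1 k}"

end

theory Submission imports Defs "HOL-Computational_Algebra.Primes" begin

text \<open>
  Both sequences are compared at powers of two. By Legendre's formula \<open>(2 ^ n)!\<close> has 2-adic
  valuation \<open>2 ^ n - 1\<close>, while that of \<open>(2 ^ n - 1)!\<close> is smaller by \<open>n\<close>, so \<open>S2\<close> takes the value
  \<open>2 ^ n\<close> exactly on the \<open>n\<close> integers in between. On the other side, exactly \<open>n\<close> of the \<open>2 ^ n - 1\<close>
  positive integers below \<open>2 ^ n\<close> have the form \<open>2 ^ m - 1\<close>, so \<open>2 ^ n\<close> is the term of index
  \<open>2 ^ n - n\<close> of the enumeration, and the neighbouring terms are found by counting as well.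
\<close>

lemma multiplicity_two_odd: "odd m \<Longrightarrow> multiplicity 2 m = 0" for m :: nat
  by (rule not_dvd_imp_multiplicity_0)

lemma multiplicity_two_fact_Suc:
  "multiplicity 2 (fact (Suc m) :: nat) = multiplicity 2 (Suc m) + multiplicity 2 (fact m :: nat)"
  unfolding fact_Suc of_nat_id
  by (rule prime_elem_multiplicity_mult_distrib) auto

text \<open>Legendre's recursion: passing from \<open>m\<close> to \<open>Suc m\<close> adds an odd
  factor, which contributes nothing, and \<open>2 * Suc m\<close>, which contributes one more than
  \<open>Suc m\<close>.\<close>

lemma multiplicity_two_fact_double:
  "multiplicity 2 (fact (2 * m) :: nat) = m + multiplicity 2 (fact m :: nat)"
proof (induction m)
  case (Suc m)
  have "multiplicity 2 (2 * Suc m) = Suc (multiplicity 2 (Suc m))"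
    by (rule multiplicity_times_same) auto
  moreover have "multiplicity 2 (Suc (2 * m)) = 0"
    by (rule multiplicity_two_odd) simp
  moreover have "2 * Suc m = Suc (Suc (2 * m))"
    by simp
  ultimately show ?case
    using Suc by (simp only: multiplicity_two_fact_Suc)
qed simp

lemma multiplicity_two_fact_power: "multiplicity 2 (fact (2 ^ n) :: nat) = 2 ^ n - 1"
  by (induction n) (simp_all add: multiplicity_two_fact_double)

lemma multiplicity_two_fact_power_minus_1:
  "multiplicity 2 (fact (2 ^ n - 1) :: nat) = 2 ^ n - 1 - n"
proof -
  have "multiplicity 2 (2 ^ n :: nat) = n"
    by (rule multiplicity_same_power) auto
  then show ?thesis
    using multiplicity_two_fact_Suc[of "2 ^ n - 1"] multiplicity_two_fact_power[of n] by simp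
qed

text \<open>The factor \<open>2 ^ n - 1\<close> is odd, so removing it keeps the valuation; for
  \<open>n = 0\<close> it would be 0.\<close>

lemma multiplicity_two_fact_power_minus_2:
  assumes "n \<ge> 1"
  shows "multiplicity 2 (fact (2 ^ n - 2) :: nat) = 2 ^ n - 1 - n"
proof -
  have "(2::nat) ^ 1 \<le> 2 ^ n"
    using assms by (rule power_increasing) simp
  then have "Suc (2 ^ n - 2) = 2 ^ n - 1" "odd (2 ^ n - 1 :: nat)"
    using assms by auto
  then show ?thesis
    using multiplicity_two_fact_Suc[of "2 ^ n - 2"] multiplicity_two_fact_power_minus_1[of n]
      multiplicity_two_odd[of "2 ^ n - 1"]
    by simp
qed

text \<open>Removing the factor \<open>2 ^ n - 2\<close> lowers the valuation, since this factor is
  even and, for \<open>n \<ge> 2\<close>, nonzero.\<close>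

lemma multiplicity_two_fact_power_minus_3:
  assumes "n \<ge> 2"
  shows "multiplicity 2 (fact (2 ^ n - 3) :: nat) < 2 ^ n - 1 - n"
proof -
  have "(2::nat) ^ 2 \<le> 2 ^ n"
    using assms by (rule power_increasing) simp
  then have *: "Suc (2 ^ n - 3) = 2 ^ n - 2"
    by simp
  have "multiplicity 2 (2 ^ n - 2 :: nat) \<ge> 1"
    using assms \<open>2 ^ 2 \<le> 2 ^ n\<close> by (intro multiplicity_geI) auto
  then show ?thesis
    using multiplicity_two_fact_Suc[of "2 ^ n - 3"] multiplicity_two_fact_power_minus_2[of n] assms
    unfolding * by simp
qed

text \<open>Divisibility of \<open>fact j\<close> by \<open>2 ^ k\<close> persists as
  \<open>j\<close> grows, so \<open>S2 k \<le> j\<close> just says that \<open>k\<close> is at most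
  the valuation of \<open>fact j\<close>. The value \<open>Suc m\<close> is then located by
  comparing two consecutive factorials.\<close>

lemma S2_eq_Suc_iff:
  "S2 k = Suc m \<longleftrightarrow>
     multiplicity 2 (fact m :: nat) < k \<and> k \<le> multiplicity 2 (fact (Suc m) :: nat)"
proof -
  have dvd_iff: "2 ^ k dvd (fact j :: nat) \<longleftrightarrow> k \<le> multiplicity 2 (fact j :: nat)" for j
    by (rule power_dvd_iff_le_multiplicity) auto
  have mono: "2 ^ k dvd (fact j :: nat)" if "2 ^ k dvd (fact i :: nat)" "i \<le> j" for i j
    using that fact_dvd dvd_trans by blast
  \<comment> \<open>The witness \<open>2 * k\<close> shows that the set under \<open>LEAST\<close>
    is nonempty.\<close>
  have "k \<le> multiplicity 2 (fact (2 * k) :: nat)"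
    by (simp add: multiplicity_two_fact_double)
  then have "2 ^ k dvd (fact (2 * k) :: nat)"
    by (simp only: dvd_iff)
  then have S2: "2 ^ k dvd (fact (S2 k) :: nat)"
    unfolding S2_def by (rule LeastI)
  have least: "S2 k \<le> j" if "2 ^ k dvd (fact j :: nat)" for j
    unfolding S2_def using that by (rule Least_le)
  have "S2 k \<le> j \<longleftrightarrow> 2 ^ k dvd (fact j :: nat)" for j
    using S2 mono least by blast
  moreover have "S2 k = Suc m \<longleftrightarrow> S2 k \<le> Suc m \<and> \<not> S2 k \<le> m"
    by auto
  ultimately show ?thesis
    unfolding dvd_iff by auto
qed

lemma S2_eq_power_iff: "S2 k = 2 ^ n \<longleftrightarrow> 2 ^ n - n \<le> k \<and> k \<le> 2 ^ n - 1"
proof -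
  have "Suc (2 ^ n - 1) = 2 ^ n"
    by simp
  then have "S2 k = 2 ^ n \<longleftrightarrow> 2 ^ n - 1 - n < k \<and> k \<le> 2 ^ n - 1"
    using S2_eq_Suc_iff[of k "2 ^ n - 1"]
    by (simp only: multiplicity_two_fact_power multiplicity_two_fact_power_minus_1)
  also have "2 ^ n - 1 - n < k \<longleftrightarrow> 2 ^ n - n \<le> k"
    using less_exp[of n] by linarith
  finally show ?thesis .
qed

text \<open>The enumeration is increasing and starts at index 0, so the index of an element is the
  number of elements below it. This turns every evaluation of \<open>nM\<close> into a
  count.\<close>

lemma enumerate_card_less:
  fixes A :: "nat set"
  assumes "infinite A" "x \<in> A"
  shows "enumerate A (card {y \<in> A. y < x}) = x"
proof -
  obtain j where j: "enumerate A j = x"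
    using assms enumerate_Ex by blast
  have "{y \<in> A. y < x} = enumerate A ` {..<j}"
  proof (intro equalityI subsetI)
    fix y assume "y \<in> {y \<in> A. y < x}"
    then obtain i where "enumerate A i = y" "y < x"
      using assms enumerate_Ex by blast
    then show "y \<in> enumerate A ` {..<j}"
      using j enumerate_mono_iff[OF assms(1)] by blast
  next
    fix y assume "y \<in> enumerate A ` {..<j}"
    then obtain i where "i < j" "y = enumerate A i"
      by blast
    then show "y \<in> {y \<in> A. y < x}"
      using j enumerate_in_set[OF assms(1)] enumerate_mono_iff[OF assms(1)] by blast
  qed
  moreover have "inj_on (enumerate A) {..<j}"
    using assms(1) strict_mono_enumerate strict_mono_imp_inj_on inj_on_subset subset_UNIV by metis
  ultimately show ?thesis
    using j by (simp add: card_image)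
qed

lemma even_in_non_Mersenne: "even j \<Longrightarrow> j \<ge> 1 \<Longrightarrow> j \<in> non_Mersenne"
  by (auto simp: non_Mersenne_def)

text \<open>Modulo 4: if \<open>2 ^ n + 2 = 2 ^ m\<close>, both powers are divisible by 4, hence so
  is 2. For \<open>n = 1\<close> the claim fails, as 3 is a Mersenne number.\<close>

lemma power_plus_1_in_non_Mersenne:
  assumes "n \<ge> 2"
  shows "2 ^ n + 1 \<in> non_Mersenne"
proof -
  have "2 ^ n + 1 \<noteq> (2 ^ m - 1 :: nat)" for m
  proof
    assume "2 ^ n + 1 = (2 ^ m - 1 :: nat)"
    then have eq: "2 ^ n + 2 = (2 ^ m :: nat)"
      by linarith
    have n4: "(4::nat) dvd 2 ^ n"
      using le_imp_power_dvd[OF assms, of "2::nat"] by simp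
    have "(2::nat) ^ 1 < 2 ^ m"
      by (simp flip: eq)
    then have "1 < m"
      using power_less_imp_less_exp[of "2::nat" 1 m] by simp
    then have "(4::nat) dvd 2 ^ m"
      using le_imp_power_dvd[of 2 m "2::nat"] by simp
    then have "(4::nat) dvd 2"
      using n4 dvd_add_right_iff unfolding eq[symmetric] by blast
    then show False
      by simp
  qed
  then show ?thesis
    by (auto simp: non_Mersenne_def)
qed

lemma infinite_non_Mersenne: "infinite non_Mersenne"
proof -
  have "\<exists>j>i. j \<in> non_Mersenne" for i
    using even_in_non_Mersenne[of "2 * Suc i"] by (intro exI[of _ "2 * Suc i"]) simp
  then show ?thesis
    by (simp add: infinite_nat_iff_unbounded)
qed

lemma card_non_Mersenne_less_power: "card {y \<in> non_Mersenne. y < 2 ^ n} = 2 ^ n - 1 - n"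
proof -
  \<comment> \<open>These are the numbers to be removed from \<open>{1..<2 ^ n}\<close>; the
    exponent 0 is left out because it gives 0.\<close>
  define M :: "nat set" where "M = (\<lambda>m. 2 ^ m - 1) ` {1..n}"
  have bound: "2 ^ m - 1 < (2 ^ n :: nat) \<longleftrightarrow> m \<le> n" for m
  proof -
    have "2 ^ m - 1 < (2 ^ n :: nat) \<longleftrightarrow> 2 ^ m \<le> (2 ^ n :: nat)"
      using less_exp[of m] by linarith
    then show ?thesis
      by simp
  qed
  have pos: "(1::nat) \<le> 2 ^ m - 1" if "m \<ge> 1" for m
    using power_increasing[OF that, of "2::nat"] by simp
  have "{y \<in> non_Mersenne. y < 2 ^ n} = {1..<2 ^ n} - M"
    using bound by (auto simp: non_Mersenne_def M_def)
  moreover have "M \<subseteq> {1..<2 ^ n}"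
    using bound pos by (auto simp: M_def)
  moreover have "inj_on (\<lambda>m. 2 ^ m - 1 :: nat) {1..n}"
    by (rule inj_onI) (simp add: eq_diff_iff)
  then have "card M = n"
    by (simp add: M_def card_image)
  ultimately show ?thesis
    by (simp add: card_Diff_subset finite_subset)
qed

lemma nM_eqI: "x \<in> non_Mersenne \<Longrightarrow> card {y \<in> non_Mersenne. y < x} = k - 1 \<Longrightarrow> nM k = x"
  using enumerate_card_less[OF infinite_non_Mersenne, of x] by (simp add: nM_def)

lemma nM_less: "1 \<le> i \<Longrightarrow> i < j \<Longrightarrow> nM i < nM j"
  unfolding nM_def by (rule enumerate_mono[OF _ infinite_non_Mersenne]) simp

lemma nM_power_minus:
  assumes "n \<ge> 1"
  shows "nM (2 ^ n - n) = 2 ^ n"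
  using assms by (intro nM_eqI even_in_non_Mersenne) (auto simp: card_non_Mersenne_less_power)

text \<open>Since \<open>2 ^ n - 1\<close> is skipped, \<open>2 ^ n - 2\<close> is the term just
  before \<open>2 ^ n\<close>, and the count drops by one.\<close>

lemma nM_power_minus_minus_1:
  assumes "n \<ge> 2"
  shows "nM (2 ^ n - n - 1) = 2 ^ n - 2"
proof (rule nM_eqI)
  have ge: "(2::nat) ^ 2 \<le> 2 ^ n"
    using assms by (rule power_increasing) simp
  show mem: "2 ^ n - 2 \<in> non_Mersenne"
    using ge assms by (intro even_in_non_Mersenne) auto
  have nonmem: "2 ^ n - 1 \<notin> non_Mersenne"
    using assms by (auto simp: non_Mersenne_def intro!: exI[of _ n])
  have "y < 2 ^ n \<longleftrightarrow> y < 2 ^ n - 2 \<or> y = 2 ^ n - 2 \<or> y = 2 ^ n - 1" for y :: nat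
    using ge by auto
  then have "{y \<in> non_Mersenne. y < 2 ^ n} = insert (2 ^ n - 2) {y \<in> non_Mersenne. y < 2 ^ n - 2}"
    using mem nonmem by auto
  then have "card {y \<in> non_Mersenne. y < 2 ^ n} = Suc (card {y \<in> non_Mersenne. y < 2 ^ n - 2})"
    by simp
  then show "card {y \<in> non_Mersenne. y < 2 ^ n - 2} = 2 ^ n - n - 1 - 1"
    by (simp add: card_non_Mersenne_less_power)
qed

lemma nM_power_minus_plus_1:
  assumes "n \<ge> 2"
  shows "nM (2 ^ n - n + 1) = 2 ^ n + 1"
proof (rule nM_eqI)
  show "2 ^ n + 1 \<in> non_Mersenne"
    using assms by (rule power_plus_1_in_non_Mersenne)
  have "2 ^ n \<in> non_Mersenne"
    using assms by (intro even_in_non_Mersenne) auto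
  then have "{y \<in> non_Mersenne. y < 2 ^ n + 1} = insert (2 ^ n) {y \<in> non_Mersenne. y < 2 ^ n}"
    by auto
  then show "card {y \<in> non_Mersenne. y < 2 ^ n + 1} = 2 ^ n - n + 1 - 1"
    by (simp add: card_non_Mersenne_less_power Suc_diff_Suc)
qed

theorem lemma6p5:
  fixes n :: nat
  assumes "n \<ge> 1"
  shows "(S2 (2 ^ n - n) = 2 ^ n \<and>
          (\<forall>k. S2 k = 2 ^ n \<longleftrightarrow> 2 ^ n - n \<le> k \<and> k \<le> 2 ^ n - 1)) \<and>
         (2 ^ n - n \<in> SNM \<and> (\<forall>k\<in>{2 ^ n - n + 1..2 ^ n - 1}. k \<notin> SNM)) \<and>
         (n \<ge> 2 \<longrightarrow> 2 ^ n - n - 1 \<in> SNM \<and> S2 (2 ^ n - n - 1) = 2 ^ n - 2) \<and>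
         (n \<ge> 3 \<longrightarrow> 2 ^ n - n + 1 \<in> SNM1)"
proof (intro conjI allI impI ballI)
  have pos: "1 \<le> 2 ^ n - n"
    using less_exp[of n] by linarith
  show S2: "S2 (2 ^ n - n) = 2 ^ n"
    using assms by (simp add: S2_eq_power_iff)
  show "S2 k = 2 ^ n \<longleftrightarrow> 2 ^ n - n \<le> k \<and> k \<le> 2 ^ n - 1" for k
    by (rule S2_eq_power_iff)
  show "2 ^ n - n \<in> SNM"
    using pos S2 nM_power_minus[OF assms] by (simp add: SNM_def)
  \<comment> \<open>On this range \<open>S2\<close> stays constant while \<open>nM\<close> has
    already moved strictly past \<open>2 ^ n\<close>.\<close>
  show "k \<notin> SNM" if "k \<in> {2 ^ n - n + 1..2 ^ n - 1}" for k
  proof -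
    have "S2 k = 2 ^ n"
      using that by (simp add: S2_eq_power_iff)
    moreover have "2 ^ n < nM k"
      using nM_less[OF pos, of k] nM_power_minus[OF assms] that by simp
    ultimately show ?thesis
      by (simp add: SNM_def)
  qed
  \<comment> \<open>The index is exactly the valuation of \<open>fact (2 ^ n - 2)\<close>, and the
    preceding factorial falls short of it.\<close>
  show S2': "S2 (2 ^ n - n - 1) = 2 ^ n - 2" if "n \<ge> 2"
  proof -
    have "(2::nat) ^ 2 \<le> 2 ^ n"
      using that by (rule power_increasing) simp
    then have "Suc (2 ^ n - 3) = 2 ^ n - 2"
      by simp
    then show ?thesis
      using S2_eq_Suc_iff[of "2 ^ n - n - 1" "2 ^ n - 3"] multiplicity_two_fact_power_minus_2[OF assms]
        multiplicity_two_fact_power_minus_3[OF that]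
      by simp
  qed
  show "2 ^ n - n - 1 \<in> SNM" if "n \<ge> 2"
  proof -
    \<comment> \<open>A natural number lies strictly below this difference, so it is
      positive.\<close>
    have "1 \<le> 2 ^ n - n - 1"
      using multiplicity_two_fact_power_minus_3[OF that] by simp
    then show ?thesis
      using S2'[OF that] nM_power_minus_minus_1[OF that] by (simp add: SNM_def)
  qed
  show "2 ^ n - n + 1 \<in> SNM1" if "n \<ge> 3"
  proof -
    have "2 ^ n - n + 1 \<le> 2 ^ n - 1"
      using that less_exp[of n] by linarith
    then have "S2 (2 ^ n - n + 1) = 2 ^ n"
      by (simp add: S2_eq_power_iff)
    \<comment> \<open>The correction in \<open>nM1\<close> lowers \<open>2 ^ n + 1\<close> to
      \<open>2 ^ n\<close>, the value that \<open>S2\<close> still takes here.\<close>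
    moreover have "nM1 (2 ^ n - n + 1) = nM (2 ^ n - n + 1) - 1"
      unfolding nM1_def using that by auto
    ultimately show ?thesis
      using nM_power_minus_plus_1[of n] that by (simp add: SNM1_def)
  qed
qed

end
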